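(* Let $r\ge 4$ be an integer, let $G$ be a graph with $t=\chi_{\mathrm f}(G)\ge 2$, let $\mathcal K$ be a $(<r)$-cycle clique cover of $G$, and let $p\in(0,1)$. Suppose that $b=b(\mathcal K)<\infty$ and that, for some $D\ge 0$ and $0<\xi<1/(2t)$, $$\sum_{K\in\mathcal K}\sum_{v\in V(K)}\Pr(Z_{K,v}>D)\le \xi .$$ Then $$h_r^{\mathrm f}(G)\ge \frac{t}{(bD+1)\bigl(8\log_{1/(1-p)}(2et)+4\bigr)}.$$ In particular, along any sequence of triples $(G,p,D)$ with $p\in(0,1)$ and $D\ge 0$, each with a $(<r)$-cycle clique cover $\mathcal K$ of $G$ with $b=b(\mathcal K)<\infty$ and a number $0<\xi<1/(2t)$ satisfying $\sum_{K\in\mathcal K}\sum_{v\in V(K)}\Pr(Z_{K,v}>D)\le \xi$, and with $t=\chi_{\mathrm f}(G)\to\infty$, if $$bD+1=o\left(\frac{pt}{\log t}\right),$$ then $h_r^{\mathrm f}(G)\to\infty$.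
   Context: All graphs are finite and simple; subgraphs need not be induced. $\chi_{\mathrm f}$ is the fractional chromatic number; $e$ in $2et$ is Euler's number; $\log$ is natural unless a base is displayed. The girth of a forest is $\infty$. $h_r^{\mathrm f}(G)=\max\{\chi_{\mathrm f}(H):H\subseteq G,\ \operatorname{girth}(H)\ge r\}$. A family $\mathcal K$ of cliques (complete subgraphs) of $G$ is a $(<r)$-cycle clique cover if every cycle of $G$ of length less than $r$ is contained in some member of $\mathcal K$. Its local overlap is $b(\mathcal K)=\max_{v\in V(G)}|\{K\in\mathcal K: v\in V(K)\}|$. For $K\in\mathcal K$ and $v\in V(K)$, $Z_{K,v}$ is the number of cycles of length less than $r$ containing $v$ in $K[p]$, the random spanning subgraph of $K$ obtained by retaining each edge independently with probability $p$. *)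

theory Defs
  imports "HOL-Probability.Probability" "HOL-Probability.Product_PMF"
    "HOL-Library.Ramsey" "HOL-Library.Extended_Nat" "HOL-Library.Landau_Symbols"
begin

datatype 'a graph = Graph (verts: "'a set") (edges: "'a set set")

definition finite_simple_graph :: "'a graph \<Rightarrow> bool" where
  "finite_simple_graph G \<longleftrightarrow> finite (verts G) \<and> edges G \<subseteq> [verts G]\<^bsup>2\<^esup>"

text \<open>Subgraphs are neither required to be induced nor to be spanning.\<close>

definition subgraph :: "'a graph \<Rightarrow> 'a graph \<Rightarrow> bool" where
  "subgraph H G \<longleftrightarrow> finite_simple_graph H \<and> verts H \<subseteq> verts G \<and> edges H \<subseteq> edges G"

subsection \<open>Fractional chromatic number\<close>

definition independent_sets :: "'a graph \<Rightarrow> 'a set set" where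
  "independent_sets G = {I. I \<subseteq> verts G \<and> indep I (edges G)}"

definition fractional_colouring :: "'a graph \<Rightarrow> ('a set \<Rightarrow> real) \<Rightarrow> bool" where
  "fractional_colouring G w \<longleftrightarrow>
     (\<forall>I\<in>independent_sets G. 0 \<le> w I) \<and>
     (\<forall>v\<in>verts G. 1 \<le> (\<Sum>I | I \<in> independent_sets G \<and> v \<in> I. w I))"

definition fractional_chromatic_number :: "'a graph \<Rightarrow> real" where
  "fractional_chromatic_number G =
     Inf {\<Sum>I\<in>independent_sets G. w I | w. fractional_colouring G w}"

subsection \<open>Cycles and girth\<close>

text \<open>
  A cycle is a graph, not a closed walk: rotating or reversing the vertex list \<open>xs\<close>
  gives the same cycle, so cycles are counted without start vertex or orientation.
\<close>

definition is_cycle :: "'a graph \<Rightarrow> bool" where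
  "is_cycle C \<longleftrightarrow>
     (\<exists>xs. distinct xs \<and> 3 \<le> length xs \<and> verts C = set xs \<and>
           edges C = {{xs ! i, xs ! (Suc i mod length xs)} | i. i < length xs})"

definition cycles :: "'a graph \<Rightarrow> 'a graph set" where
  "cycles G = {C. is_cycle C \<and> subgraph C G}"

definition cycle_length :: "'a graph \<Rightarrow> nat" where
  "cycle_length C = card (edges C)"

text \<open>The infimum of the empty set in \<open>enat\<close> is \<open>\<infinity>\<close>, so forests have infinite girth.\<close>

definition girth :: "'a graph \<Rightarrow> enat" where
  "girth G = (INF C\<in>cycles G. enat (cycle_length C))"

definition high_girth_frac_chromatic :: "nat \<Rightarrow> 'a graph \<Rightarrow> real" where
  "high_girth_frac_chromatic r G =
     Max {fractional_chromatic_number H | H. subgraph H G \<and> enat r \<le> girth H}"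

subsection \<open>Clique covers of short cycles\<close>

definition cycle_clique_cover :: "nat \<Rightarrow> 'a graph \<Rightarrow> 'a graph set \<Rightarrow> bool" where
  "cycle_clique_cover r G \<K> \<longleftrightarrow>
     (\<forall>K\<in>\<K>. subgraph K G \<and> clique (verts K) (edges K)) \<and>
     (\<forall>C\<in>cycles G. cycle_length C < r \<longrightarrow> (\<exists>K\<in>\<K>. subgraph C K))"

definition local_overlap :: "'a graph \<Rightarrow> 'a graph set \<Rightarrow> enat" where
  "local_overlap G \<K> =
     (SUP v\<in>verts G. if finite {K\<in>\<K>. v \<in> verts K}
                     then enat (card {K\<in>\<K>. v \<in> verts K}) else \<infinity>)"

subsection \<open>Random spanning subgraphs\<close>

text \<open>The value \<open>False\<close> is the default that \<open>Pi_pmf\<close> takes outside the edge set of \<open>G\<close>.\<close>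

definition random_spanning_subgraph :: "real \<Rightarrow> 'a graph \<Rightarrow> 'a graph pmf" where
  "random_spanning_subgraph p G =
     map_pmf (\<lambda>retained. Graph (verts G) {e \<in> edges G. retained e})
       (Pi_pmf (edges G) False (\<lambda>_. bernoulli_pmf p))"

definition short_cycle_count :: "nat \<Rightarrow> 'a \<Rightarrow> 'a graph \<Rightarrow> nat" where
  "short_cycle_count r v H = card {C \<in> cycles H. cycle_length C < r \<and> v \<in> verts C}"

definition prob_many_short_cycles ::
  "nat \<Rightarrow> real \<Rightarrow> real \<Rightarrow> 'a graph \<Rightarrow> 'a \<Rightarrow> real" where
  "prob_many_short_cycles r p D K v =
     measure_pmf.prob (random_spanning_subgraph p K) {H. real (short_cycle_count r v H) > D}"

end

theory Submission
  imports Defs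
begin

text \<open>
  By linear programming duality there is a probability weight \<open>\<mu>\<close> on the vertices giving every
  independent set of \<open>G\<close> weight at most about \<open>1 / t\<close>. With \<open>q = 1 - p\<close> and
  \<open>L = 8 log\<^bsub>1/q\<^esub>(2 e t) + 4\<close>, a set \<open>S\<close> of weight at least \<open>L / t\<close> must be dense in \<open>G\<close>: order
  the vertices by decreasing weight; the vertices of \<open>S\<close> having fewer than \<open>\<lfloor>L / 2\<rfloor>\<close> earlier neighbours
  in \<open>S\<close> can be coloured greedily, so they carry at most about half of the weight, and Abel
  summation yields an initial segment \<open>T\<close> of \<open>S\<close>, of size \<open>k\<close> say, that spans at least
  \<open>k log\<^bsub>1/q\<^esub>(2 e t)\<close> edges and lies among the first \<open>3 t k / 4\<close> vertices. A union bound over such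
  \<open>T\<close> shows that with probability at least \<open>2 / 5\<close> no set of weight \<open>L / t\<close> becomes independent
  in \<open>G[p]\<close>. Since \<open>\<xi> < 1 / 4\<close>, some outcome also has at most \<open>b D\<close> short cycles through every
  vertex. Colouring the vertices greedily with \<open>b \<lfloor>D\<rfloor> + 1\<close> colours leaves no short cycle monochromatic,
  and the colour class of largest weight induces the required subgraph.
\<close>

subsection \<open>Fractional colourings and duality\<close>

text \<open>
  The strategy \<open>\<mu>\<close> is proportional to the shortfalls \<open>max 0 (c - val l i)\<close> of a near-minimiser \<open>l\<close> of
  the sum of their squares: otherwise a short step from \<open>l\<close> towards some column would reduce it.
\<close>

lemma approximate_minimax:
  fixes A :: "'r \<Rightarrow> 'c \<Rightarrow> real"
  assumes finR: "finite R" and finC: "finite C" and neC: "C \<noteq> {}"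
    and A: "\<And>i j. i \<in> R \<Longrightarrow> j \<in> C \<Longrightarrow> 0 \<le> A i j \<and> A i j \<le> 1"
    and "d < c"
    and mixed: "\<And>l. (\<And>j. j \<in> C \<Longrightarrow> 0 \<le> l j) \<Longrightarrow> sum l C = 1 \<Longrightarrow> \<exists>i\<in>R. (\<Sum>j\<in>C. l j * A i j) \<le> d"
  obtains \<mu> where "\<And>i. i \<in> R \<Longrightarrow> 0 \<le> \<mu> i" "sum \<mu> R = 1"
    "\<And>j. j \<in> C \<Longrightarrow> (\<Sum>i\<in>R. \<mu> i * A i j) \<le> c"
proof -
  define \<Delta> where "\<Delta> = {l. (\<forall>j\<in>C. 0 \<le> l j) \<and> sum l C = (1::real)}"
  define val where "val l i = (\<Sum>j\<in>C. l j * A i j)" for l i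
  define y where "y l i = max 0 (c - val l i)" for l i
  define \<Phi> where "\<Phi> l = (\<Sum>i\<in>R. (y l i)\<^sup>2)" for l
  define \<delta> where "\<delta> = c - d"
  have \<delta>: "0 < \<delta>" using \<open>d < c\<close> by (simp add: \<delta>_def)
  \<comment> \<open>Some row has value at most \<open>d\<close>, so its shortfall alone is at least
    \<delta>. This keeps \<Phi> away from 0 on the whole simplex \<Delta>.\<close>
  have \<Phi>_ge: "\<delta>\<^sup>2 \<le> \<Phi> l" if "l \<in> \<Delta>" for l
  proof -
    have "\<exists>i\<in>R. (\<Sum>j\<in>C. l j * A i j) \<le> d"
      using that unfolding \<Delta>_def by (intro mixed) blast+
    then obtain i where i: "i \<in> R" "val l i \<le> d" unfolding val_def by blast
    have "\<delta> \<le> y l i" using i(2) by (simp add: \<delta>_def y_def)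
    then have "\<delta>\<^sup>2 \<le> (y l i)\<^sup>2" using \<delta> by (intro power_mono) auto
    also have "\<dots> \<le> \<Phi> l"
      unfolding \<Phi>_def using i(1) finR by (intro member_le_sum) auto
    finally show ?thesis .
  qed
  obtain j0 where j0: "j0 \<in> C" using neC by blast
  have "(\<lambda>j. if j = j0 then 1 else 0) \<in> \<Delta>"
    using j0 finC by (simp add: \<Delta>_def)
  then have ne: "\<Delta> \<noteq> {}" by blast
  have neR: "R \<noteq> {}"
  proof
    assume "R = {}"
    then have "\<Phi> l = 0" for l by (simp add: \<Phi>_def)
    then show False using \<Phi>_ge ne \<delta> by fastforce
  qed
  define n where "n = real (card R)"
  have n: "1 \<le> n" using neR finR by (simp add: n_def Suc_le_eq card_gt_0_iff)
  \<comment> \<open>Step length. Since \<open>s * n \<le> \<delta>\<^sup>2\<close>, the quadratic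
    error \<open>n * s\<^sup>2\<close> of a step is at most \<open>s * \<delta>\<^sup>2\<close>,
    which is also the slack allowed in the choice of \<open>l\<close>; so the infimum need not be
    attained.\<close>
  define s where "s = min 1 (\<delta>\<^sup>2 / n)"
  have s: "0 < s" "s \<le> 1" "s * n \<le> \<delta>\<^sup>2"
    using \<delta> n by (auto simp: s_def min_def field_simps)
  have bdd: "bdd_below (\<Phi> ` \<Delta>)"
    by (rule bdd_belowI[of _ 0]) (auto simp: \<Phi>_def intro: sum_nonneg)
  have "Inf (\<Phi> ` \<Delta>) < Inf (\<Phi> ` \<Delta>) + s * \<delta>\<^sup>2" using s \<delta> by simp
  then obtain l where l: "l \<in> \<Delta>" "\<Phi> l < Inf (\<Phi> ` \<Delta>) + s * \<delta>\<^sup>2"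
    using cInf_lessD[of "\<Phi> ` \<Delta>"] ne by (auto simp only: image_is_empty)
  have near: "\<Phi> l \<le> \<Phi> l' + s * \<delta>\<^sup>2" if "l' \<in> \<Delta>" for l'
    using cInf_lower[OF imageI[OF that] bdd] l(2) by simp
  have val01: "0 \<le> val l i \<and> val l i \<le> 1" if "i \<in> R" for i
  proof
    show "0 \<le> val l i"
      unfolding val_def using l(1) A that by (intro sum_nonneg) (auto simp: \<Delta>_def)
    have "val l i \<le> sum l C"
      unfolding val_def using l(1) A that
      by (intro sum_mono) (auto simp: \<Delta>_def intro: mult_left_le)
    then show "val l i \<le> 1" using l(1) by (simp add: \<Delta>_def)
  qed
  define Y where "Y = (\<Sum>i\<in>R. y l i)"
  have y_nonneg: "0 \<le> y l i" for i by (simp add: y_def)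
  have "0 < Y"
  proof (rule ccontr)
    assume "\<not> 0 < Y"
    then have "Y = 0" using sum_nonneg[of R "y l"] y_nonneg by (simp add: Y_def)
    then have "\<forall>i\<in>R. y l i = 0"
      unfolding Y_def using finR y_nonneg by (subst (asm) sum_nonneg_eq_0_iff) auto
    then have "\<Phi> l = 0" by (simp add: \<Phi>_def)
    then show False using \<Phi>_ge[OF l(1)] \<delta> by simp
  qed
  \<comment> \<open>Where the shortfall is positive, the value is \<open>c\<close> minus the
    shortfall; elsewhere the product vanishes.\<close>
  have yval: "(\<Sum>i\<in>R. y l i * val l i) \<le> c * Y - \<delta>\<^sup>2"
  proof -
    have "y l i * val l i = c * y l i - (y l i)\<^sup>2" for i
      by (auto simp: y_def max_def power2_eq_square algebra_simps)
    then have "(\<Sum>i\<in>R. y l i * val l i) = c * Y - \<Phi> l"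
      by (simp add: sum_subtractf sum_distrib_left Y_def \<Phi>_def)
    then show ?thesis using \<Phi>_ge[OF l(1)] by simp
  qed
  have main: "(\<Sum>i\<in>R. y l i * A i j) \<le> c * Y" if j: "j \<in> C" for j
  proof -
    \<comment> \<open>A convex step of length \<open>s\<close> from \<open>l\<close> towards the
      pure column \<open>j\<close>, which stays in \<Delta>.\<close>
    define l' where "l' k = (1 - s) * l k + (if k = j then s else 0)" for k
    have "sum l' C = 1"
      using l(1) j finC by (simp add: l'_def sum.distrib \<Delta>_def flip: sum_distrib_left)
    then have l': "l' \<in> \<Delta>"
      using l(1) s by (auto simp: \<Delta>_def l'_def)
    define h where "h i = s * (A i j - val l i)" for i
    have "val l' i = val l i + h i" if "i \<in> R" for i
    proof -
      have "val l' i = (\<Sum>k\<in>C. (1 - s) * (l k * A i k) + (if k = j then s * A i j else 0))"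
        unfolding val_def l'_def by (intro sum.cong) (auto simp: algebra_simps)
      also have "\<dots> = (1 - s) * val l i + s * A i j"
        using j finC by (simp add: sum.distrib val_def flip: sum_distrib_left)
      finally show ?thesis by (simp add: h_def algebra_simps)
    qed
    then have y': "y l' i = max 0 (c - val l i - h i)" if "i \<in> R" for i
      using that by (simp add: y_def algebra_simps)
    \<comment> \<open>A second-order bound for the squared positive part, whose derivative is
      \<open>2 * max 0 x\<close>. It holds for all \<open>x\<close> and \<open>h\<close>, so rows
      whose shortfall vanishes or appears during the step are covered.\<close>
    have step: "(max 0 (x - h))\<^sup>2 \<le> (max 0 x)\<^sup>2 - 2 * (h * max 0 x) + h\<^sup>2" for x h :: real
    proof (cases "0 \<le> x")
      case True
      have "(max 0 (x - h))\<^sup>2 \<le> (x - h)\<^sup>2" by (simp add: max_def)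
      then show ?thesis using True by (simp add: power2_diff algebra_simps)
    next
      case False
      then have "max 0 (x - h) \<le> \<bar>h\<bar>" by auto
      then have "(max 0 (x - h))\<^sup>2 \<le> \<bar>h\<bar>\<^sup>2" by (intro power_mono) auto
      then show ?thesis using False by simp
    qed
    have h2: "(h i)\<^sup>2 \<le> s\<^sup>2" if "i \<in> R" for i
    proof -
      have "\<bar>A i j - val l i\<bar> \<le> 1" using A[OF that j] val01[OF that] by auto
      then have "\<bar>h i\<bar> \<le> s" using s by (simp add: h_def abs_mult)
      then have "\<bar>h i\<bar>\<^sup>2 \<le> s\<^sup>2" by (intro power_mono) auto
      then show ?thesis by simp
    qed
    have "\<Phi> l' \<le> (\<Sum>i\<in>R. (y l i)\<^sup>2 - 2 * (h i * y l i) + s\<^sup>2)"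
      unfolding \<Phi>_def
    proof (rule sum_mono)
      fix i assume i: "i \<in> R"
      show "(y l' i)\<^sup>2 \<le> (y l i)\<^sup>2 - 2 * (h i * y l i) + s\<^sup>2"
        using step[of "c - val l i" "h i"] h2[OF i] y'[OF i] by (simp add: y_def)
    qed
    also have "\<dots> = \<Phi> l - 2 * (\<Sum>i\<in>R. h i * y l i) + n * s\<^sup>2"
      by (simp add: sum.distrib sum_subtractf \<Phi>_def n_def flip: sum_distrib_left)
    also have "(\<Sum>i\<in>R. h i * y l i) = s * ((\<Sum>i\<in>R. y l i * A i j) - (\<Sum>i\<in>R. y l i * val l i))"
      by (simp add: h_def sum_distrib_left sum_subtractf algebra_simps flip: sum_subtractf)
    \<comment> \<open>Near-minimality of \<open>l\<close> bounds the first-order gain by slack plus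
      quadratic error. Dividing by \<open>2 * s\<close> leaves exactly the margin
      \<open>\<delta>\<^sup>2\<close> gained in \<open>yval\<close>.\<close>
    finally have "2 * s * ((\<Sum>i\<in>R. y l i * A i j) - (\<Sum>i\<in>R. y l i * val l i)) \<le> s * \<delta>\<^sup>2 + n * s\<^sup>2"
      using near[OF l'] by simp
    also have "\<dots> \<le> 2 * s * \<delta>\<^sup>2"
      using mult_left_mono[OF s(3), of s] s(1) by (simp add: power2_eq_square algebra_simps)
    finally have "(\<Sum>i\<in>R. y l i * A i j) - (\<Sum>i\<in>R. y l i * val l i) \<le> \<delta>\<^sup>2"
      using s(1) by simp
    then show ?thesis using yval by simp
  qed
  show ?thesis
  proof (rule that[of "\<lambda>i. y l i / Y"])
    show "(\<Sum>i\<in>R. y l i / Y) = 1"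
      using \<open>0 < Y\<close> by (simp add: Y_def flip: sum_divide_distrib)
    show "(\<Sum>i\<in>R. y l i / Y * A i j) \<le> c" if "j \<in> C" for j
      using main[OF that] \<open>0 < Y\<close> by (simp add: field_simps flip: sum_divide_distrib)
  qed (use y_nonneg \<open>0 < Y\<close> in auto)
qed

section \<open>The fractional chromatic number and its dual\<close>

lemma finite_independent_sets:
  "finite_simple_graph G \<Longrightarrow> finite (independent_sets G)"
  by (rule finite_subset[of _ "Pow (verts G)"])
    (auto simp: independent_sets_def finite_simple_graph_def)

lemma fractional_colouring_exists:
  assumes "finite_simple_graph G"
  shows "fractional_colouring G (\<lambda>_. 1)"
proof -
  have "1 \<le> card {I \<in> independent_sets G. v \<in> I}" if "v \<in> verts G" for v
  proof -
    have "{v} \<in> {I \<in> independent_sets G. v \<in> I}"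
      using that by (auto simp: independent_sets_def indep_def)
    then have "card {I \<in> independent_sets G. v \<in> I} \<noteq> 0"
      using finite_independent_sets[OF assms] by auto
    then show ?thesis by simp
  qed
  then show ?thesis by (auto simp: fractional_colouring_def)
qed

lemma fractional_chromatic_number_le:
  assumes "fractional_colouring G w"
  shows "fractional_chromatic_number G \<le> (\<Sum>I\<in>independent_sets G. w I)"
  unfolding fractional_chromatic_number_def
proof (rule cInf_lower)
  show "bdd_below {\<Sum>I\<in>independent_sets G. w I |w. fractional_colouring G w}"
    by (rule bdd_belowI[of _ 0]) (auto simp: fractional_colouring_def intro!: sum_nonneg)
qed (use assms in blast)

text \<open>Weak duality by double counting \<open>\<mu> v * w I\<close> over all incidences of
  \<open>v\<close> in \<open>I\<close>: the covering condition bounds this sum from below by the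
  total of \<mu>, and the cap \<open>c\<close> bounds it from above by \<open>c\<close> times the
  total of \<open>w\<close>.\<close>

lemma fractional_chromatic_number_ge:
  assumes G: "finite_simple_graph G"
    and \<mu>: "\<And>v. v \<in> verts G \<Longrightarrow> 0 \<le> \<mu> v"
    and c: "0 < c" "\<And>I. I \<in> independent_sets G \<Longrightarrow> sum \<mu> I \<le> c"
  shows "sum \<mu> (verts G) / c \<le> fractional_chromatic_number G"
  unfolding fractional_chromatic_number_def
proof (rule cInf_greatest)
  show "{\<Sum>I\<in>independent_sets G. w I |w. fractional_colouring G w} \<noteq> {}"
    using fractional_colouring_exists[OF G] by blast
next
  fix x assume "x \<in> {\<Sum>I\<in>independent_sets G. w I |w. fractional_colouring G w}"
  then obtain w where w: "fractional_colouring G w" "x = (\<Sum>I\<in>independent_sets G. w I)"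
    by blast
  have finV: "finite (verts G)" using G by (simp add: finite_simple_graph_def)
  have "sum \<mu> (verts G) \<le> (\<Sum>v\<in>verts G. \<mu> v * (\<Sum>I | I \<in> independent_sets G \<and> v \<in> I. w I))"
  proof (rule sum_mono)
    fix v assume v: "v \<in> verts G"
    then have "1 \<le> (\<Sum>I | I \<in> independent_sets G \<and> v \<in> I. w I)"
      using w(1) by (simp add: fractional_colouring_def)
    from mult_left_mono[OF this \<mu>[OF v]]
    show "\<mu> v \<le> \<mu> v * (\<Sum>I | I \<in> independent_sets G \<and> v \<in> I. w I)" by simp
  qed
  also have "\<dots> = (\<Sum>v\<in>verts G. \<Sum>I | I \<in> independent_sets G \<and> v \<in> I. \<mu> v * w I)"
    by (simp add: sum_distrib_left)
  also have "\<dots> = (\<Sum>I\<in>independent_sets G. \<Sum>v | v \<in> verts G \<and> v \<in> I. \<mu> v * w I)"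
    by (rule sum.swap_restrict) (use finV finite_independent_sets[OF G] in auto)
  also have "\<dots> = (\<Sum>I\<in>independent_sets G. w I * sum \<mu> I)"
  proof (rule sum.cong)
    fix I assume "I \<in> independent_sets G"
    then have "{v. v \<in> verts G \<and> v \<in> I} = I" by (auto simp: independent_sets_def)
    then show "(\<Sum>v | v \<in> verts G \<and> v \<in> I. \<mu> v * w I) = w I * sum \<mu> I"
      by (simp add: sum_distrib_left mult.commute)
  qed simp
  also have "\<dots> \<le> (\<Sum>I\<in>independent_sets G. w I * c)"
    using w(1) c by (intro sum_mono mult_left_mono) (auto simp: fractional_colouring_def)
  also have "\<dots> = x * c" by (simp add: w(2) sum_distrib_right)
  finally show "sum \<mu> (verts G) / c \<le> x" using c(1) by (simp add: field_simps)
qed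

text \<open>Duality up to a slack, from the game of vertices against independent sets. A mixture of
  independent sets covering every vertex by more than the reciprocal of the fractional chromatic
  number would rescale to a fractional colouring that is too light. The strict bound on
  \<open>c\<close> absorbs the error of the approximate minimax.\<close>

lemma fractional_clique_exists:
  assumes G: "finite_simple_graph G"
    and pos: "0 < fractional_chromatic_number G"
    and c: "1 / fractional_chromatic_number G < c"
  obtains \<mu> where "\<And>v. v \<in> verts G \<Longrightarrow> 0 \<le> \<mu> v" "sum \<mu> (verts G) = 1"
    "\<And>I. I \<in> independent_sets G \<Longrightarrow> sum \<mu> I \<le> c"
proof -
  let ?\<chi> = "fractional_chromatic_number G"
  let ?A = "\<lambda>v I. of_bool (v \<in> I) :: real"
  have finV: "finite (verts G)" using G by (simp add: finite_simple_graph_def)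
  note finI = finite_independent_sets[OF G]
  have mixed: "\<exists>v\<in>verts G. (\<Sum>I\<in>independent_sets G. l I * ?A v I) \<le> 1 / ?\<chi>"
    if nonneg: "\<And>I. I \<in> independent_sets G \<Longrightarrow> 0 \<le> l I" and total: "sum l (independent_sets G) = 1"
    for l
  proof (rule ccontr)
    assume neg: "\<not> ?thesis"
    define val where "val v = (\<Sum>I\<in>independent_sets G. l I * ?A v I)" for v
    have "verts G \<noteq> {}"
    proof
      assume "verts G = {}"
      then have "fractional_colouring G (\<lambda>_. 0)" by (simp add: fractional_colouring_def)
      from fractional_chromatic_number_le[OF this] pos show False by simp
    qed
    \<comment> \<open>Division by the least coverage \<open>s\<close> makes the mixture a fractional
      colouring of total weight \<open>1 / s\<close>. The minimum is over a nonempty set by the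
      preceding step.\<close>
    define s where "s = Min (val ` verts G)"
    have s: "1 / ?\<chi> < s"
      using neg finV \<open>verts G \<noteq> {}\<close> by (auto simp: s_def val_def)
    then have s0: "0 < s" using pos by (smt (verit) divide_pos_pos)
    have "fractional_colouring G (\<lambda>I. l I / s)"
      unfolding fractional_colouring_def
    proof (intro conjI ballI)
      fix v assume v: "v \<in> verts G"
      have "(\<Sum>I | I \<in> independent_sets G \<and> v \<in> I. l I) = val v"
        unfolding val_def using finI by (simp add: sum.inter_filter of_bool_def if_distrib cong: if_cong)
      moreover have "s \<le> val v" using v finV by (simp add: s_def)
      ultimately show "1 \<le> (\<Sum>I | I \<in> independent_sets G \<and> v \<in> I. l I / s)"
        using s0 by (simp flip: sum_divide_distrib)
    qed (use nonneg s0 in auto)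
    from fractional_chromatic_number_le[OF this] have "?\<chi> \<le> 1 / s"
      using total by (simp flip: sum_divide_distrib)
    then show False using s s0 pos by (simp add: field_simps)
  qed
  have "{} \<in> independent_sets G" by (simp add: independent_sets_def indep_def)
  then have neI: "independent_sets G \<noteq> {}" by blast
  obtain \<mu> where \<mu>: "\<And>v. v \<in> verts G \<Longrightarrow> 0 \<le> \<mu> v" "sum \<mu> (verts G) = 1"
    "\<And>I. I \<in> independent_sets G \<Longrightarrow> (\<Sum>v\<in>verts G. \<mu> v * ?A v I) \<le> c"
    using approximate_minimax[OF finV finI neI _ c, of ?A] mixed by auto
  show ?thesis
  proof (rule that[OF \<mu>(1,2)])
    fix I assume I: "I \<in> independent_sets G"
    then have "sum \<mu> I = (\<Sum>v\<in>verts G. \<mu> v * ?A v I)"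
      using finV
      by (intro sum.mono_neutral_cong_left) (auto simp: independent_sets_def)
    then show "sum \<mu> I \<le> c" using \<mu>(3)[OF I] by simp
  qed auto
qed

subsection \<open>Greedy colourings and dense prefixes\<close>

text \<open>Greedy colouring, one vertex at a time. Each hyperedge through the new vertex forbids
  only one colour, so at most \<open>s\<close> of the \<open>s + 1\<close> colours are
  blocked.\<close>

lemma hypergraph_colouring:
  fixes F :: "'a set set"
  assumes "finite V" and finF: "finite F"
    and nontrivial: "\<And>C v. C \<in> F \<Longrightarrow> C \<noteq> {} \<and> C \<noteq> {v}"
    and deg: "\<And>v. v \<in> V \<Longrightarrow> card {C \<in> F. v \<in> C} \<le> s"
  obtains f :: "'a \<Rightarrow> nat" where "f ` V \<subseteq> {..s}"
    "\<And>C i. C \<in> F \<Longrightarrow> C \<subseteq> V \<Longrightarrow> \<not> C \<subseteq> {v. f v = i}"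
proof -
  have "\<exists>f :: 'a \<Rightarrow> nat. f ` V \<subseteq> {..s} \<and> (\<forall>C\<in>F. C \<subseteq> V \<longrightarrow> (\<forall>i. \<not> C \<subseteq> {v. f v = i}))"
    using \<open>finite V\<close> deg
  proof (induction V rule: finite_induct)
    case empty
    then show ?case using nontrivial by auto
  next
    case (insert v W)
    from insert obtain f :: "'a \<Rightarrow> nat" where
      f: "f ` W \<subseteq> {..s}" "\<forall>C\<in>F. C \<subseteq> W \<longrightarrow> (\<forall>i. \<not> C \<subseteq> {v. f v = i})"
      by (metis insertCI)
    \<comment> \<open>One other vertex is chosen in each hyperedge through \<open>v\<close>;
      differing from its colour already prevents that hyperedge from being monochromatic.\<close>
    define B where "B = (\<lambda>C. f (SOME u. u \<in> C - {v})) ` {C \<in> F. v \<in> C}"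
    have "card B \<le> card {C \<in> F. v \<in> C}"
      unfolding B_def by (rule card_image_le) (use finF in auto)
    also have "\<dots> < card {..s}" using insert.prems[of v] by simp
    finally have "\<not> {..s} \<subseteq> B"
      using card_mono[of B "{..s}"] finF by (auto simp: B_def)
    then obtain i where i: "i \<le> s" "i \<notin> B" by auto
    show ?case
    proof (intro exI[of _ "f(v := i)"] conjI ballI impI allI)
      show "(f(v := i)) ` insert v W \<subseteq> {..s}"
        using f(1) i(1) by auto
    next
      fix C k assume C: "C \<in> F" "C \<subseteq> insert v W"
      show "\<not> C \<subseteq> {u. (f(v := i)) u = k}"
      proof (cases "v \<in> C")
        case True
        have "\<exists>u. u \<in> C - {v}" using nontrivial[OF C(1)] by blast
        then have u: "(SOME u. u \<in> C - {v}) \<in> C - {v}" (is "?u \<in> _") by (rule someI_ex)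
        have "f ?u \<in> B" using C(1) True by (auto simp: B_def)
        then have "f ?u \<noteq> i" using i(2) by auto
        then show ?thesis using u True by auto
      next
        case False
        then have "C \<subseteq> W" using C(2) by auto
        then have "\<not> C \<subseteq> {u. f u = k}" using f(2) C(1) by simp
        then obtain u where "u \<in> C" "f u \<noteq> k" by (auto simp: subset_iff)
        moreover from this False have "u \<noteq> v" by blast
        ultimately show ?thesis by auto
      qed
    qed
  qed
  then obtain f :: "'a \<Rightarrow> nat" where f: "f ` V \<subseteq> {..s}"
      "\<forall>C\<in>F. C \<subseteq> V \<longrightarrow> (\<forall>i. \<not> C \<subseteq> {v. f v = i})"
    by (elim exE conjE)
  show ?thesis by (rule that[of f]) (use f in auto)
qed

text \<open>Greedy colouring in increasing order. The induction removes the largest element, which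
  leaves the earlier neighbours of all others unchanged.\<close>

lemma degenerate_colouring:
  fixes S :: "nat set"
  assumes "finite S" and "\<And>j. j \<in> S \<Longrightarrow> card {i \<in> S. i < j \<and> adj i j} < m"
  obtains f where "f ` S \<subseteq> {..<m}"
    "\<And>i j. i \<in> S \<Longrightarrow> j \<in> S \<Longrightarrow> i < j \<Longrightarrow> adj i j \<Longrightarrow> f i \<noteq> f j"
proof -
  have "\<exists>f. f ` S \<subseteq> {..<m} \<and> (\<forall>i\<in>S. \<forall>j\<in>S. i < j \<longrightarrow> adj i j \<longrightarrow> f i \<noteq> f j)"
    using assms
  proof (induction S rule: finite_linorder_max_induct)
    case empty
    then show ?case by auto
  next
    case (insert b S)
    have "card {i \<in> S. i < j \<and> adj i j} < m" if "j \<in> S" for j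
    proof -
      have "{i \<in> S. i < j \<and> adj i j} = {i \<in> insert b S. i < j \<and> adj i j}"
        using insert.hyps(2) that by auto
      then show ?thesis using insert.prems[of j] that by simp
    qed
    with insert.IH obtain f where
      f: "f ` S \<subseteq> {..<m}" "\<forall>i\<in>S. \<forall>j\<in>S. i < j \<longrightarrow> adj i j \<longrightarrow> f i \<noteq> f j"
      by blast
    define B where "B = f ` {i \<in> insert b S. i < b \<and> adj i b}"
    have "card B \<le> card {i \<in> insert b S. i < b \<and> adj i b}"
      unfolding B_def by (rule card_image_le) (use insert.hyps in auto)
    also have "\<dots> < card {..<m}" using insert.prems[of b] by simp
    finally have "\<not> {..<m} \<subseteq> B"
      using card_mono[of B "{..<m}"] insert.hyps(1) by (auto simp: B_def)
    then obtain c where c: "c < m" "c \<notin> B" by auto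
    show ?case
    proof (intro exI[of _ "f(b := c)"] conjI ballI impI)
      show "(f(b := c)) ` insert b S \<subseteq> {..<m}"
        using f(1) c(1) by auto
    next
      fix i j assume ij: "i \<in> insert b S" "j \<in> insert b S" "i < j" "adj i j"
      then have i: "i \<in> S" "i \<noteq> b" using insert.hyps(2) by auto
      show "(f(b := c)) i \<noteq> (f(b := c)) j"
      proof (cases "j = b")
        case True
        then have "f i \<in> B" using ij i by (auto simp: B_def)
        then show ?thesis using True i c(2) by auto
      next
        case False
        then show ?thesis using f(2) ij i by auto
      qed
    qed
  qed
  then obtain f where "f ` S \<subseteq> {..<m}"
      "\<forall>i\<in>S. \<forall>j\<in>S. i < j \<longrightarrow> adj i j \<longrightarrow> f i \<noteq> f j"
    by (elim exE conjE)
  then show ?thesis by (intro that[of f]) auto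
qed

section \<open>Abel summation and dense initial segments\<close>

text \<open>Used in contrapositive form: a positive weighted sum yields an initial segment whose
  unweighted sum is positive.\<close>

lemma sum_nonincreasing_weights_nonpos:
  fixes w a :: "nat \<Rightarrow> real"
  assumes "\<And>i j. i \<le> j \<Longrightarrow> j < n \<Longrightarrow> w j \<le> w i"
    and "\<And>i. i < n \<Longrightarrow> 0 \<le> w i"
    and "\<And>j. j \<le> n \<Longrightarrow> (\<Sum>i<j. a i) \<le> 0"
  shows "(\<Sum>i<n. w i * a i) \<le> 0"
proof -
  \<comment> \<open>Abel summation as an invariant: passing from one weight to the next smaller one
    only raises its product with a nonpositive partial sum. At \<open>j = 0\<close> both sides are
    0, whatever weight the truncated subtraction selects.\<close>
  have "(\<Sum>i<j. w i * a i) \<le> w (j - 1) * (\<Sum>i<j. a i)" if "j \<le> n" for j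
    using that
  proof (induction j)
    case (Suc j)
    have "w (j - 1) * (\<Sum>i<j. a i) \<le> w j * (\<Sum>i<j. a i)"
      using assms(1)[of "j - 1" j] assms(3)[of j] Suc.prems by (intro mult_right_mono_neg) auto
    then show ?case using Suc by (simp add: algebra_simps)
  qed simp
  from this[of n] have "(\<Sum>i<n. w i * a i) \<le> w (n - 1) * (\<Sum>i<n. a i)" by simp
  also have "\<dots> \<le> 0"
  proof (cases "n = 0")
    case False
    then show ?thesis using assms(2)[of "n - 1"] assms(3)[of n] by (intro mult_nonneg_nonpos) auto
  qed simp
  finally show ?thesis .
qed

text \<open>
  Truncating the back-degrees at \<open>m\<close> makes the dense prefix that Abel summation produces
  occupy a fraction at least \<open>4 / (3 t)\<close> of the first \<open>J\<close> indices.
\<close>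

lemma dense_prefix_exists:
  fixes w :: "nat \<Rightarrow> real" and t c :: real
  assumes mono: "\<And>i j. i \<le> j \<Longrightarrow> j < n \<Longrightarrow> w j \<le> w i"
    and nonneg: "\<And>i. i < n \<Longrightarrow> 0 \<le> w i"
    and total: "(\<Sum>i<n. w i) = 1"
    and indep: "\<And>I. I \<subseteq> {..<n} \<Longrightarrow> (\<forall>i\<in>I. \<forall>j\<in>I. i < j \<longrightarrow> \<not> adj i j) \<Longrightarrow> sum w I \<le> c"
    and S: "S \<subseteq> {..<n}" and "0 < t" and "0 < m"
    and heavy: "m * c + 1 / t < 3 / 4 * sum w S"
  obtains T J where "T \<subseteq> S" "T \<subseteq> {..<J}" "T \<noteq> {}" "4 * real J \<le> 3 * t * card T"
    "real m / 4 * card T \<le> card {(i, j). i \<in> T \<and> j \<in> T \<and> i < j \<and> adj i j}"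
proof -
  have finS: "finite S" using S finite_subset by blast
  define deg where "deg j = card {i \<in> S. i < j \<and> adj i j}" for j
  \<comment> \<open>These elements split into \<open>m\<close> independent classes of weight at most
    \<open>c\<close> each, so the remaining, high back-degree part of \<open>S\<close> still carries
    much weight.\<close>
  define S' where "S' = {j \<in> S. deg j < m}"
  have S'S: "S' \<subseteq> S" by (auto simp: S'_def)
  have finS': "finite S'" using finS S'S finite_subset by blast
  have "card {i \<in> S'. i < j \<and> adj i j} < m" if "j \<in> S'" for j
  proof -
    have "card {i \<in> S'. i < j \<and> adj i j} \<le> deg j"
      unfolding deg_def by (rule card_mono) (use finS S'S in auto)
    then show ?thesis using that by (simp add: S'_def)
  qed
  from degenerate_colouring[OF finS' this] obtain f where
    f: "f ` S' \<subseteq> {..<m}" "\<And>i j. i \<in> S' \<Longrightarrow> j \<in> S' \<Longrightarrow> i < j \<Longrightarrow> adj i j \<Longrightarrow> f i \<noteq> f j"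
    by blast
  have "sum w S' = (\<Sum>k<m. \<Sum>i | i \<in> S' \<and> f i = k. w i)"
    by (rule sum.group[symmetric]) (use finS' f(1) in auto)
  also have "\<dots> \<le> (\<Sum>k<m. c)"
  proof (rule sum_mono, rule indep, goal_cases)
    case (2 k)
    show ?case
    proof (intro ballI impI)
      fix i j assume "i \<in> {i \<in> S'. f i = k}" "j \<in> {i \<in> S'. f i = k}" "i < j"
      then show "\<not> adj i j" using f(2)[of i j] by auto
    qed
  qed (use S S'S in auto)
  finally have w_S': "sum w S' \<le> m * c" by simp
  \<comment> \<open>A positive sum of \<open>a\<close> over an initial segment must deliver two
    things: the charge \<open>m / 4\<close> per element of \<open>S\<close> gives the edge density,
    and the charge \<open>m / t\<close> per index limits the length of the segment.\<close>
  define a where "a j = (if j \<in> S then min (real (deg j)) m - real m / 4 else 0) - real m / t" for j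
  have "0 < (\<Sum>i<n. w i * a i)"
  proof -
    have "real m * (sum w S - sum w S') = (\<Sum>i\<in>S - S'. w i * m)"
      using sum.subset_diff[OF S'S finS, of w] by (simp add: sum_distrib_left mult.commute)
    also have "\<dots> = (\<Sum>i\<in>S - S'. w i * min (real (deg i)) m)"
      by (intro sum.cong) (auto simp: S'_def min_def)
    also have "\<dots> \<le> (\<Sum>i\<in>S. w i * min (real (deg i)) m)"
      using nonneg S finS by (intro sum_mono2) auto
    finally have deg_sum: "real m * (sum w S - sum w S') \<le> (\<Sum>i\<in>S. w i * min (real (deg i)) m)" .
    have "(\<Sum>i<n. w i * a i)
        = (\<Sum>i<n. (if i \<in> S then w i * min (real (deg i)) m - w i * (real m / 4) else 0) - w i * (m / t))"
      by (intro sum.cong) (auto simp: a_def algebra_simps)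
    also have "\<dots> = (\<Sum>i<n. if i \<in> S then w i * min (real (deg i)) m - w i * (real m / 4) else 0) - m / t"
      using total by (simp add: sum_subtractf flip: sum_distrib_right sum_divide_distrib)
    also have "(\<Sum>i<n. if i \<in> S then w i * min (real (deg i)) m - w i * (real m / 4) else 0)
        = (\<Sum>i\<in>S. w i * min (real (deg i)) m - w i * (real m / 4))"
      using S by (simp add: sum.inter_restrict[symmetric] Int_absorb1)
    also have "\<dots> = (\<Sum>i\<in>S. w i * min (real (deg i)) m) - sum w S * (m / 4)"
      by (simp add: sum_subtractf flip: sum_distrib_right sum_divide_distrib)
    finally have "(\<Sum>i<n. w i * a i) \<ge> m * (sum w S - sum w S') - sum w S * (m / 4) - m / t"
      using deg_sum by simp
    moreover have "m * (sum w S - sum w S') - sum w S * (m / 4) - m / t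
        = m * (3 / 4 * sum w S - sum w S' - 1 / t)"
      by (simp add: algebra_simps)
    moreover have "0 < m * (3 / 4 * sum w S - sum w S' - 1 / t)"
      using heavy w_S' \<open>0 < m\<close> by simp
    ultimately show ?thesis by simp
  qed
  then have "\<exists>J\<le>n. \<not> (\<Sum>i<J. a i) \<le> 0"
    using sum_nonincreasing_weights_nonpos[where w = w and a = a and n = n, OF mono nonneg]
    by (meson not_less)
  then obtain J where J: "J \<le> n" "0 < (\<Sum>i<J. a i)" by auto
  define T where "T = S \<inter> {..<J}"
  have finT: "finite T" by (simp add: T_def)
  have "(\<Sum>i<J. a i) = (\<Sum>i\<in>T. min (real (deg i)) m - real m / 4) - J * (m / t)"
    using sum.inter_restrict[of "{..<J}" "\<lambda>i. min (real (deg i)) m - real m / 4" S]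
    by (simp only: a_def sum_subtractf T_def Int_commute) simp
  then have excess: "J * (m / t) + real m / 4 * card T < (\<Sum>i\<in>T. min (real (deg i)) m)"
    using J(2) by (simp add: sum_subtractf algebra_simps)
  \<comment> \<open>Each element of \<open>T\<close> contributes at most \<open>m\<close>, of which
    \<open>m / 4\<close> is charged; the remaining three quarters pay \<open>m / t\<close> for each
    of the \<open>J\<close> indices.\<close>
  have "(\<Sum>i\<in>T. min (real (deg i)) m) \<le> (\<Sum>i\<in>T. real m)" by (rule sum_mono) auto
  then have "J * (m / t) < real m * (3 / 4 * card T)"
    using excess by (simp only: sum_constant of_nat_mult) argo
  then have "real m * (J / t) < real m * (3 / 4 * card T)"
    by (simp only: times_divide_eq_right mult.commute[of "real J"])
  then have J_T: "J / t < 3 / 4 * card T" using \<open>0 < m\<close> by (simp only: mult_less_cancel_left_pos of_nat_0_less_iff)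
  show ?thesis
  proof (rule that[of T J])
    show "T \<noteq> {}"
    proof
      assume "T = {}"
      then have "J / t < 0" using J_T by simp
      moreover have "0 \<le> J / t" using \<open>0 < t\<close> by simp
      ultimately show False by simp
    qed
    show "4 * real J \<le> 3 * t * card T" using J_T \<open>0 < t\<close> by (simp add: field_simps)
    have "real m / 4 * card T \<le> (\<Sum>i\<in>T. min (real (deg i)) m)"
      using excess \<open>0 < t\<close> by (smt (verit) divide_nonneg_nonneg mult_nonneg_nonneg of_nat_0_le_iff)
    also have "\<dots> \<le> (\<Sum>j\<in>T. real (deg j))" by (rule sum_mono) auto
    \<comment> \<open>Since \<open>T\<close> is an initial segment of \<open>S\<close>, back-degrees
      within \<open>S\<close> and within \<open>T\<close> agree on \<open>T\<close>.\<close>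
    also have "\<dots> = (\<Sum>j\<in>T. real (card {i \<in> T. i < j \<and> adj i j}))"
      by (intro sum.cong refl arg_cong[where f = "\<lambda>x. real (card x)"])
        (auto simp: deg_def T_def intro!: arg_cong[where f = card])
    also have "\<dots> = card (SIGMA j:T. {i \<in> T. i < j \<and> adj i j})"
      using finT by (simp add: card_SigmaI)
    also have "card (SIGMA j:T. {i \<in> T. i < j \<and> adj i j})
        = card {(i, j). i \<in> T \<and> j \<in> T \<and> i < j \<and> adj i j}"
      by (rule bij_betw_same_card[of prod.swap])
        (auto simp: bij_betw_def inj_on_def image_iff)
    finally show "real m / 4 * card T \<le> card {(i, j). i \<in> T \<and> j \<in> T \<and> i < j \<and> adj i j}" .
  qed (auto simp: T_def)
qed

subsection \<open>Random subgraphs\<close>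

text \<open>A deterministic counterpart of \<open>random_spanning_subgraph\<close>: a single edge
  configuration \<omega> acts on the whole graph and on all cliques of the cover at once.\<close>

definition retained_subgraph :: "('a set \<Rightarrow> bool) \<Rightarrow> 'a graph \<Rightarrow> 'a graph" where
  "retained_subgraph \<omega> G = Graph (verts G) {e \<in> edges G. \<omega> e}"

lemma retained_subgraph_simps [simp]:
  "verts (retained_subgraph \<omega> G) = verts G"
  "edges (retained_subgraph \<omega> G) = {e \<in> edges G. \<omega> e}"
  by (simp_all add: retained_subgraph_def)

lemma independent_sets_antimono:
  "S \<in> independent_sets G \<Longrightarrow> T \<subseteq> S \<Longrightarrow> T \<in> independent_sets G"
  by (simp add: independent_sets_def indep_def subset_iff)

lemma finite_edges: "finite_simple_graph G \<Longrightarrow> finite (edges G)"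
  by (auto simp: finite_simple_graph_def intro: finite_subset finite_imp_finite_nsets)

lemma subgraph_retained_subgraph:
  "finite_simple_graph G \<Longrightarrow> subgraph (retained_subgraph \<omega> G) G"
  by (auto simp: subgraph_def finite_simple_graph_def)

text \<open>The coupling: restricting the product measure on the edges of \<open>G\<close> to those
  of \<open>K\<close> gives the product measure of \<open>K\<close>. Events about different cliques
  thus live on one probability space and admit a union bound.\<close>

lemma random_spanning_subgraph_eq_map_Pi_pmf:
  assumes "finite_simple_graph G" and "subgraph K G"
  shows "random_spanning_subgraph p K
    = map_pmf (\<lambda>\<omega>. retained_subgraph \<omega> K) (Pi_pmf (edges G) False (\<lambda>_. bernoulli_pmf p))"
proof -
  have "Pi_pmf (edges K) False (\<lambda>_. bernoulli_pmf p)
      = map_pmf (\<lambda>\<omega> e. if e \<in> edges K then \<omega> e else False)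
          (Pi_pmf (edges G) False (\<lambda>_. bernoulli_pmf p))"
    using assms finite_edges by (intro Pi_pmf_subset) (auto simp: subgraph_def)
  then show ?thesis
    by (auto simp: random_spanning_subgraph_def retained_subgraph_def map_pmf_comp intro!: map_pmf_cong)
qed

text \<open>Independence of \<open>T\<close> forces every edge inside \<open>T\<close> to be
  deleted, and deletions are independent; the event is enclosed in a product event.\<close>

lemma prob_independent_le:
  fixes p :: real
  assumes G: "finite_simple_graph G" and p: "0 \<le> p" "p \<le> 1"
  shows "measure_pmf.prob (Pi_pmf (edges G) False (\<lambda>_. bernoulli_pmf p))
      {\<omega>. T \<in> independent_sets (retained_subgraph \<omega> G)} \<le> (1 - p) ^ card {e \<in> edges G. e \<subseteq> T}"
proof -
  let ?B = "\<lambda>e. if e \<subseteq> T then {False} else UNIV"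
  have "{\<omega>. T \<in> independent_sets (retained_subgraph \<omega> G)} \<subseteq> Pi (edges G) ?B"
  proof (intro subsetI Pi_I)
    fix \<omega> e assume \<omega>: "\<omega> \<in> {\<omega>. T \<in> independent_sets (retained_subgraph \<omega> G)}" and e: "e \<in> edges G"
    show "\<omega> e \<in> ?B e"
    proof (cases "e \<subseteq> T")
      case True
      obtain x y where "e = {x, y}" "x \<noteq> y"
        using e G by (auto simp: finite_simple_graph_def elim!: nsets2_E dest!: subsetD)
      then show ?thesis using \<omega> e True by (auto simp: independent_sets_def indep_def)
    qed simp
  qed
  then have "measure_pmf.prob (Pi_pmf (edges G) False (\<lambda>_. bernoulli_pmf p))
      {\<omega>. T \<in> independent_sets (retained_subgraph \<omega> G)}
      \<le> measure_pmf.prob (Pi_pmf (edges G) False (\<lambda>_. bernoulli_pmf p)) (Pi (edges G) ?B)"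
    by (intro measure_pmf.finite_measure_mono) auto
  also have "\<dots> = (\<Prod>e\<in>edges G. measure_pmf.prob (bernoulli_pmf p) (?B e))"
    using finite_edges[OF G] by (rule measure_Pi_pmf_Pi)
  also have "\<dots> = (\<Prod>e\<in>edges G. if e \<subseteq> T then 1 - p else 1)"
    using p by (intro prod.cong) (auto simp: measure_pmf_single)
  also have "\<dots> = (1 - p) ^ card {e \<in> edges G. e \<subseteq> T}"
    using finite_edges[OF G] by (simp flip: prod.inter_filter)
  finally show ?thesis .
qed

section \<open>Union bound over dense initial segments\<close>

lemma nonincreasing_enumeration:
  fixes w :: "'a \<Rightarrow> real"
  assumes "finite V"
  obtains g where "bij_betw g {..<card V} V"
    "\<And>i j. i \<le> j \<Longrightarrow> j < card V \<Longrightarrow> w (g j) \<le> w (g i)"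
proof -
  obtain xs where xs: "set xs = V" "distinct xs"
    using finite_distinct_list[OF assms] by blast
  define ys where "ys = sort_key (\<lambda>v. - w v) xs"
  have ys: "set ys = V" "distinct ys" "sorted (map (\<lambda>v. - w v) ys)"
    using xs by (simp_all add: ys_def)
  have len: "length ys = card V" using ys distinct_card by metis
  show ?thesis
  proof (rule that[of "(!) ys"])
    show "bij_betw ((!) ys) {..<card V} V"
      by (rule bij_betw_nth) (use ys(1,2) len in auto)
    show "w (ys ! j) \<le> w (ys ! i)" if "i \<le> j" "j < card V" for i j
      using sorted_nth_mono[OF ys(3) that(1)] that len by simp
  qed
qed

text \<open>The usual estimate \<open>J ^ k / fact k\<close>, combined with the fact that
  \<open>k ^ k / fact k\<close> is a single term of the series of \<open>exp k\<close>.\<close>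

lemma binomial_le_exp:
  assumes "real J \<le> x * real k" "0 \<le> x"
  shows "real (J choose k) \<le> (exp 1 * x) ^ k"
proof -
  have k: "real k ^ k / fact k \<le> exp (real k)"
  proof -
    have "(\<Sum>i\<in>{k}. real k ^ i /\<^sub>R fact i) \<le> exp (real k)"
      unfolding exp_def by (rule sum_le_suminf[OF summable_exp_generic]) auto
    then show ?thesis by (simp add: divide_inverse mult.commute)
  qed
  have "real (J choose k) * fact k \<le> real J ^ k"
    using binomial_fact_pow[of J k] by (metis of_nat_fact of_nat_le_iff of_nat_mult of_nat_power)
  then have "real (J choose k) \<le> real J ^ k / fact k"
    by (simp add: field_simps)
  also have "\<dots> \<le> (x * real k) ^ k / fact k"
    using assms by (intro divide_right_mono power_mono) auto
  also have "\<dots> = x ^ k * (real k ^ k / fact k)" by (simp add: power_mult_distrib)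
  also have "\<dots> \<le> x ^ k * exp (real k)" using k assms(2) by (intro mult_left_mono) auto
  also have "\<dots> = (exp 1 * x) ^ k"
    by (simp add: power_mult_distrib mult.commute flip: exp_of_nat_mult)
  finally show ?thesis .
qed

text \<open>
  The number of candidate prefixes of size \<open>k\<close> is at most \<open>(3 e t / 4) ^ k\<close>, each is independent
  with probability at most \<open>(2 e t) ^ (- k)\<close>, and the geometric series of \<open>3 / 8\<close> sums to \<open>3 / 5\<close>.
\<close>

lemma heavy_independent_sets_unlikely:
  fixes G :: "'a graph" and p t :: real
  defines "L \<equiv> 8 * log (1 / (1 - p)) (2 * exp 1 * t) + 4"
  assumes G: "finite_simple_graph G" and t: "t = fractional_chromatic_number G" "1 \<le> t"
    and p: "0 < p" "p < 1"
  obtains \<mu> where "\<And>v. v \<in> verts G \<Longrightarrow> 0 \<le> \<mu> v" "sum \<mu> (verts G) = 1"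
    "measure_pmf.prob (Pi_pmf (edges G) False (\<lambda>_. bernoulli_pmf p))
       {\<omega>. \<exists>S\<in>independent_sets (retained_subgraph \<omega> G). L / t \<le> sum \<mu> S} \<le> 3 / 5"
proof -
  define l where "l = log (1 / (1 - p)) (2 * exp 1 * t)"
  have et: "1 < 2 * exp 1 * t"
  proof -
    have "1 * 1 < (2 * exp 1) * t" using t(2) exp_ge_add_one_self[of 1] by (intro mult_less_le_imp_less) auto
    then show ?thesis by simp
  qed
  have l: "0 < l" using p et t(2) unfolding l_def by (intro zero_less_log_cancel_iff[THEN iffD2]) auto
  have L: "L = 8 * l + 4" by (simp add: L_def l_def)
  have q_powr: "(1 - p) powr l = 1 / (2 * exp 1 * t)"
  proof -
    have "(1 / (1 - p)) powr l = 2 * exp 1 * t"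
      unfolding l_def using p t(2) by (intro powr_log_cancel) auto
    then show ?thesis using p t(2) by (simp add: powr_divide field_simps)
  qed
  \<comment> \<open>Since \<open>L / 2 = 4 * l + 2\<close>, rounding down still leaves
    \<open>m / 4 \<ge> l\<close>, the edge density required of a candidate.\<close>
  define m where "m = nat \<lfloor>L / 2\<rfloor>"
  have "real m = of_int \<lfloor>L / 2\<rfloor>" using l by (simp add: m_def L)
  then have m: "4 * l + 1 \<le> m" "m \<le> L / 2"
    using floor_correct[of "L / 2"] L by linarith+
  have m0: "0 < m" using m(1) l by linarith
  \<comment> \<open>There is room for \<open>c\<close> because
    \<open>m \<le> 4 * l + 2 < 6 * l + 2 = 3 / 4 * L - 1\<close>. The upper bound on
    \<open>c\<close> is the heaviness condition for dense prefixes, solved for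
    \<open>c\<close>.\<close>
  have "1 / t < (3 / 4 * L - 1) / (t * m)"
    using m m0 l t(2) by (simp add: field_simps L)
  then obtain c where c: "1 / t < c" "c < (3 / 4 * L - 1) / (t * m)"
    using dense by blast
  have "c * (t * m) < 3 / 4 * L - 1" using c(2) m0 t(2) by (subst (asm) pos_less_divide_eq) auto
  then have "(m * c + 1 / t) * t < 3 / 4 * L" using t(2) by (simp add: algebra_simps)
  then have "m * c + 1 / t < (3 / 4 * L) / t"
    using t(2) by (subst pos_less_divide_eq) auto
  then have c': "m * c + 1 / t < 3 / 4 * (L / t)" by simp
  obtain \<mu> where \<mu>: "\<And>v. v \<in> verts G \<Longrightarrow> 0 \<le> \<mu> v" "sum \<mu> (verts G) = 1"
    "\<And>I. I \<in> independent_sets G \<Longrightarrow> sum \<mu> I \<le> c"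
    using fractional_clique_exists[OF G] t c(1) by auto
  have finV: "finite (verts G)" using G by (simp add: finite_simple_graph_def)
  define n where "n = card (verts G)"
  obtain g where g: "bij_betw g {..<n} (verts G)"
    "\<And>i j. i \<le> j \<Longrightarrow> j < n \<Longrightarrow> \<mu> (g j) \<le> \<mu> (g i)"
    unfolding n_def using nonincreasing_enumeration[OF finV] by blast
  have g_inj: "inj_on g {..<n}" and g_im: "g ` {..<n} = verts G"
    using g(1) by (auto simp: bij_betw_def)
  have \<mu>_g: "0 \<le> \<mu> (g i)" if "i < n" for i
    using \<mu>(1) that g_im by (metis imageI lessThan_iff)
  \<comment> \<open>A dense prefix with \<open>k\<close> elements lies among the first
    \<open>J \<le> 3 * t * k / 4\<close> vertices, so \<open>P k\<close> contains it for every
    possible \<open>J\<close>.\<close>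
  define P where "P k = g ` ({..<n} \<inter> {..<nat \<lfloor>3 * t * real k / 4\<rfloor>})" for k
  define e where "e T = card {f \<in> edges G. f \<subseteq> T}" for T
  define Fam where "Fam k = {T. T \<subseteq> P k \<and> card T = k \<and> l * k \<le> e T}" for k
  let ?M = "Pi_pmf (edges G) False (\<lambda>_. bernoulli_pmf p)"
  let ?ind = "\<lambda>T. {\<omega>. T \<in> independent_sets (retained_subgraph \<omega> G)}"
  have P_sub: "P k \<subseteq> verts G" for k using g_im by (auto simp: P_def)
  have finP: "finite (P k)" for k by (simp add: P_def)
  have finFam: "finite (Fam k)" for k
    by (rule finite_subset[of _ "Pow (P k)"]) (use finP in \<open>auto simp: Fam_def\<close>)
  \<comment> \<open>Independence passes to subsets, so a heavy independent set forces one of the few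
    dense candidates to be independent. Only candidates enter the union bound.\<close>
  have witness: "\<exists>k\<in>{1..n}. \<exists>T\<in>Fam k. \<omega> \<in> ?ind T"
    if S: "S \<in> independent_sets (retained_subgraph \<omega> G)" "L / t \<le> sum \<mu> S" for \<omega> S
  proof -
    define S' where "S' = {i. i < n \<and> g i \<in> S}"
    have S_im: "S = g ` S'"
      using S(1) g_im by (fastforce simp: S'_def independent_sets_def)
    have inj_sub: "inj_on g I" if "I \<subseteq> {..<n}" for I
      using inj_on_subset[OF g_inj that] .
    have S'_sub: "S' \<subseteq> {..<n}" by (auto simp: S'_def)
    have "sum \<mu> S = sum (\<mu> \<circ> g) S'"
      unfolding S_im using inj_sub[OF S'_sub] by (rule sum.reindex)
    then have heavy: "m * c + 1 / t < 3 / 4 * sum (\<mu> \<circ> g) S'" using S(2) c' by simp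
    obtain T J where T: "T \<subseteq> S'" "T \<subseteq> {..<J}" "T \<noteq> {}" "4 * real J \<le> 3 * t * card T"
      "real m / 4 * card T \<le> card {(i, j). i \<in> T \<and> j \<in> T \<and> i < j \<and> {g i, g j} \<in> edges G}"
    proof (rule dense_prefix_exists[of n "\<mu> \<circ> g" "\<lambda>i j. {g i, g j} \<in> edges G" c S' t m])
      fix I assume I: "I \<subseteq> {..<n}" "\<forall>i\<in>I. \<forall>j\<in>I. i < j \<longrightarrow> {g i, g j} \<notin> edges G"
      have "{g i, g j} \<notin> edges G" if "i \<in> I" "j \<in> I" "g i \<noteq> g j" for i j
      proof (cases "i < j")
        case True
        then show ?thesis using I(2) that by blast
      next
        case False
        then have "j < i" using that by (cases i j rule: linorder_cases) auto
        then have "{g j, g i} \<notin> edges G" using I(2) that by blast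
        then show ?thesis by (simp add: insert_commute)
      qed
      moreover have "g ` I \<subseteq> verts G" using image_mono[OF I(1), of g] g_im by simp
      ultimately have "g ` I \<in> independent_sets G"
        by (auto simp: independent_sets_def indep_def)
      from \<mu>(3)[OF this] show "sum (\<mu> \<circ> g) I \<le> c"
        by (simp add: sum.reindex[OF inj_sub[OF I(1)]])
    next
      show "(\<Sum>i<n. (\<mu> \<circ> g) i) = 1"
        using \<mu>(2) by (simp add: sum.reindex[OF g_inj] flip: g_im)
    qed (use g(2) \<mu>_g t(2) m0 heavy S'_sub in auto)
    have T_sub: "T \<subseteq> {..<n}" using T(1) S'_sub by blast
    have finT: "finite T" using T_sub finite_subset by blast
    define k where "k = card T"
    have card_gT: "card (g ` T) = k" unfolding k_def by (rule card_image[OF inj_sub[OF T_sub]])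
    have k: "1 \<le> k" "k \<le> n"
      using T(3) finT card_mono[OF _ T_sub] by (auto simp: k_def Suc_le_eq card_gt_0_iff)
    have "g ` T \<subseteq> P k"
    proof -
      have "J \<le> nat \<lfloor>3 * t * real k / 4\<rfloor>"
        using T(4) by (simp add: k_def le_nat_floor)
      then have "T \<subseteq> {..<n} \<inter> {..<nat \<lfloor>3 * t * real k / 4\<rfloor>}"
        using T_sub T(2) by auto
      then show ?thesis unfolding P_def by (rule image_mono)
    qed
    moreover have "l * k \<le> e (g ` T)"
    proof -
      have "card {(i, j). i \<in> T \<and> j \<in> T \<and> i < j \<and> {g i, g j} \<in> edges G} \<le> e (g ` T)"
        unfolding e_def
      proof (rule card_inj_on_le[of "\<lambda>(i, j). {g i, g j}"])
        \<comment> \<open>The condition \<open>i < j\<close> fixes one orientation of each edge, so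
          distinct pairs give distinct edges.\<close>
        show "inj_on (\<lambda>(i, j). {g i, g j}) {(i, j). i \<in> T \<and> j \<in> T \<and> i < j \<and> {g i, g j} \<in> edges G}"
        proof (rule inj_onI, clarify)
          fix i j i' j' assume ij: "i \<in> T" "j \<in> T" "i < j" "i' \<in> T" "j' \<in> T" "i' < j'"
            and "{g i, g j} = {g i', g j'}"
          then have "g ` {i, j} = g ` {i', j'}" by simp
          then have "{i, j} = {i', j'}"
            using inj_on_image_eq_iff[OF inj_sub[OF T_sub], of "{i, j}" "{i', j'}"] ij by simp
          then show "i = i' \<and> j = j'" using ij by (auto simp: doubleton_eq_iff)
        qed
      qed (use finite_edges[OF G] in auto)
      moreover have "l * k \<le> real m / 4 * k"
        using m(1) l by (intro mult_right_mono) auto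
      ultimately show ?thesis using T(5) by (simp add: k_def)
    qed
    moreover have "g ` T \<in> independent_sets (retained_subgraph \<omega> G)"
    proof -
      have "g ` T \<subseteq> S" using T(1) S_im by auto
      then show ?thesis using independent_sets_antimono[OF S(1)] by simp
    qed
    ultimately have "g ` T \<in> Fam k" "\<omega> \<in> ?ind (g ` T)" using card_gT by (simp_all add: Fam_def)
    moreover have "k \<in> {1..n}" using k by simp
    ultimately show ?thesis by blast
  qed
  have ind_prob: "measure_pmf.prob ?M (?ind T) \<le> (1 / (2 * exp 1 * t)) ^ k" if "T \<in> Fam k" for T k
  proof -
    have "measure_pmf.prob ?M (?ind T) \<le> (1 - p) ^ e T"
      unfolding e_def using p by (intro prob_independent_le[OF G]) auto
    also have "\<dots> = (1 - p) powr e T" using p by (simp add: powr_realpow)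
    also have "\<dots> \<le> (1 - p) powr (l * k)"
      using that p by (intro powr_mono') (auto simp: Fam_def)
    also have "\<dots> = ((1 - p) powr l) ^ k" using p by (simp add: powr_powr[symmetric] powr_realpow)
    finally show ?thesis by (simp only: q_powr)
  qed
  have card_Fam: "real (card (Fam k)) \<le> (exp 1 * (3 / 4 * t)) ^ k" if "1 \<le> k" for k
  proof -
    define J where "J = card (P k)"
    have "real J \<le> 3 / 4 * t * real k"
    proof -
      have "J \<le> card ({..<n} \<inter> {..<nat \<lfloor>3 * t * real k / 4\<rfloor>})"
        unfolding J_def P_def by (rule card_image_le) simp
      also have "\<dots> \<le> card {..<nat \<lfloor>3 * t * real k / 4\<rfloor>}" by (rule card_mono) auto
      finally have "real J \<le> real (nat \<lfloor>3 * t * real k / 4\<rfloor>)" by simp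
      also have "\<dots> \<le> 3 * t * real k / 4"
        using t(2) by (intro of_nat_floor) auto
      finally show ?thesis by simp
    qed
    have "card (Fam k) \<le> card {T. T \<subseteq> P k \<and> card T = k}"
      by (rule card_mono) (use finP in \<open>auto simp: Fam_def\<close>)
    also have "\<dots> = J choose k" using n_subsets[OF finP] by (simp add: J_def)
    finally have "real (card (Fam k)) \<le> real (J choose k)" by simp
    also have "\<dots> \<le> (exp 1 * (3 / 4 * t)) ^ k"
      using t(2) \<open>real J \<le> 3 / 4 * t * real k\<close> by (intro binomial_le_exp) auto
    finally show ?thesis .
  qed
  have "{\<omega>. \<exists>S\<in>independent_sets (retained_subgraph \<omega> G). L / t \<le> sum \<mu> S}
      \<subseteq> (\<Union>k\<in>{1..n}. \<Union>T\<in>Fam k. ?ind T)" (is "?bad \<subseteq> _")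
    using witness by fastforce
  then have "measure_pmf.prob ?M ?bad \<le> measure_pmf.prob ?M (\<Union>k\<in>{1..n}. \<Union>T\<in>Fam k. ?ind T)"
    by (intro measure_pmf.finite_measure_mono) auto
  also have "\<dots> \<le> (\<Sum>k\<in>{1..n}. measure_pmf.prob ?M (\<Union>T\<in>Fam k. ?ind T))"
    by (intro measure_UNION_le) auto
  also have "\<dots> \<le> (\<Sum>k\<in>{1..n}. \<Sum>T\<in>Fam k. measure_pmf.prob ?M (?ind T))"
    by (intro sum_mono measure_UNION_le finFam) auto
  also have "\<dots> \<le> (\<Sum>k\<in>{1..n}. \<Sum>T\<in>Fam k. (1 / (2 * exp 1 * t)) ^ k)"
    by (intro sum_mono ind_prob)
  also have "\<dots> \<le> (\<Sum>k\<in>{1..n}. (3 / 8) ^ k)"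
  proof (rule sum_mono)
    fix k assume "k \<in> {1..n}"
    then have "(\<Sum>T\<in>Fam k. (1 / (2 * exp 1 * t)) ^ k) \<le> (exp 1 * (3 / 4 * t)) ^ k * (1 / (2 * exp 1 * t)) ^ k"
      using t(2) by (simp only: sum_constant) (intro mult_right_mono card_Fam, auto)
    also have "\<dots> = (3 / 8) ^ k"
      using t(2) by (simp add: field_simps flip: power_mult_distrib)
    finally show "(\<Sum>T\<in>Fam k. (1 / (2 * exp 1 * t)) ^ k) \<le> (3 / 8) ^ k" .
  qed
  also have "\<dots> = 3 / 5 - 3 / 5 * (3 / 8) ^ n"
    by (induction n) (simp_all add: algebra_simps)
  also have "\<dots> \<le> 3 / 5" by simp
  finally show ?thesis using that \<mu>(1,2) by blast
qed

subsection \<open>Subgraphs of high girth\<close>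

lemma finite_subgraphs:
  assumes "finite_simple_graph G"
  shows "finite {H. subgraph H G}"
proof (rule finite_subset)
  show "{H. subgraph H G} \<subseteq> (\<lambda>(V, E). Graph V E) ` (Pow (verts G) \<times> Pow (edges G))"
  proof
    fix H assume "H \<in> {H. subgraph H G}"
    then have "(verts H, edges H) \<in> Pow (verts G) \<times> Pow (edges G)"
      by (auto simp: subgraph_def)
    then show "H \<in> (\<lambda>(V, E). Graph V E) ` (Pow (verts G) \<times> Pow (edges G))"
      by (rule rev_image_eqI) simp
  qed
  show "finite ((\<lambda>(V, E). Graph V E) ` (Pow (verts G) \<times> Pow (edges G)))"
    using assms finite_edges[OF assms] by (simp add: finite_simple_graph_def)
qed

lemma finite_cycles: "finite_simple_graph G \<Longrightarrow> finite (cycles G)"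
  by (rule finite_subset[OF _ finite_subgraphs]) (auto simp: cycles_def)

lemma subgraph_trans: "subgraph H K \<Longrightarrow> subgraph K G \<Longrightarrow> subgraph H G"
  by (auto simp: subgraph_def)

definition induced_subgraph :: "'a graph \<Rightarrow> 'a set \<Rightarrow> 'a graph" where
  "induced_subgraph G X = Graph (verts G \<inter> X) {e \<in> edges G. e \<subseteq> X}"

lemma induced_subgraph_simps [simp]:
  "verts (induced_subgraph G X) = verts G \<inter> X"
  "edges (induced_subgraph G X) = {e \<in> edges G. e \<subseteq> X}"
  by (simp_all add: induced_subgraph_def)

lemma subgraph_induced_subgraph:
  "finite_simple_graph G \<Longrightarrow> subgraph (induced_subgraph G X) G"
  by (auto simp: subgraph_def finite_simple_graph_def nsets_def)

lemma independent_sets_induced_subgraph: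
  "independent_sets (induced_subgraph G X) \<subseteq> independent_sets G"
proof
  fix I assume I: "I \<in> independent_sets (induced_subgraph G X)"
  then have "I \<subseteq> X" by (simp add: independent_sets_def)
  then have "{v, w} \<subseteq> X" if "v \<in> I" "w \<in> I" for v w using that by blast
  then show "I \<in> independent_sets G"
    using I by (simp add: independent_sets_def indep_def)
qed

text \<open>The vertex sets of the short cycles form a hypergraph of degree at most
  \<open>s\<close>. In a colouring without monochromatic hyperedges no class contains a short
  cycle.\<close>

lemma high_girth_partition:
  assumes G: "finite_simple_graph G"
    and count: "\<And>v. v \<in> verts G \<Longrightarrow> short_cycle_count r v G \<le> s"
  obtains f :: "'a \<Rightarrow> nat" where "f ` verts G \<subseteq> {..s}"
    "\<And>i. enat r \<le> girth (induced_subgraph G {v. f v = i})"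
proof -
  define F where "F = verts ` {C \<in> cycles G. cycle_length C < r}"
  have finV: "finite (verts G)" using G by (simp add: finite_simple_graph_def)
  have finF: "finite F" using finite_cycles[OF G] by (simp add: F_def)
  have nontrivial: "C \<noteq> {} \<and> C \<noteq> {v}" if C: "C \<in> F" for C v
  proof -
    obtain xs where "distinct xs" "3 \<le> length xs" "C = set xs"
      using C by (auto simp: F_def cycles_def is_cycle_def)
    then have "3 \<le> card C" by (simp add: distinct_card)
    then show ?thesis by auto
  qed
  have deg: "card {C \<in> F. v \<in> C} \<le> s" if "v \<in> verts G" for v
  proof -
    \<comment> \<open>Several cycles may share a vertex set; identifying them can only lower the
      degree.\<close>
    have "{C \<in> F. v \<in> C} = verts ` {C \<in> cycles G. cycle_length C < r \<and> v \<in> verts C}"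
      by (auto simp: F_def)
    then have "card {C \<in> F. v \<in> C} \<le> short_cycle_count r v G"
      unfolding short_cycle_count_def using finite_cycles[OF G] by (simp add: card_image_le)
    then show ?thesis using count[OF that] by simp
  qed
  obtain f :: "'a \<Rightarrow> nat" where f: "f ` verts G \<subseteq> {..s}"
    "\<And>C i. C \<in> F \<Longrightarrow> C \<subseteq> verts G \<Longrightarrow> \<not> C \<subseteq> {v. f v = i}"
  proof (rule hypergraph_colouring[OF finV finF])
    show "C \<noteq> {} \<and> C \<noteq> {v}" if "C \<in> F" for C v using nontrivial[OF that] .
    show "card {C \<in> F. v \<in> C} \<le> s" if "v \<in> verts G" for v using deg[OF that] .
  qed (rule that)
  have "enat r \<le> girth (induced_subgraph G {v. f v = i})" for i
    unfolding girth_def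
  proof (rule INF_greatest)
    fix C assume C: "C \<in> cycles (induced_subgraph G {v. f v = i})"
    then have "subgraph C G"
      using subgraph_trans subgraph_induced_subgraph[OF G] by (auto simp: cycles_def)
    moreover have "is_cycle C" "verts C \<subseteq> {v. f v = i}"
      using C by (auto simp: cycles_def subgraph_def)
    ultimately have "\<not> cycle_length C < r"
      using f(2)[of "verts C" i] by (auto simp: F_def cycles_def subgraph_def)
    then show "enat r \<le> enat (cycle_length C)" by simp
  qed
  with f(1) show ?thesis by (rule that)
qed

text \<open>A short cycle that survives in \<open>G\<close> lies in some clique of the cover, and
  its edges survive there too. Only the at most \<open>b\<close> cliques through \<open>v\<close>
  can contribute.\<close>

lemma short_cycle_count_retained_le:
  assumes G: "finite_simple_graph G" and cover: "cycle_clique_cover r G \<K>"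
    and overlap: "local_overlap G \<K> = enat b" and v: "v \<in> verts G"
    and few: "\<And>K. K \<in> \<K> \<Longrightarrow> v \<in> verts K \<Longrightarrow> short_cycle_count r v (retained_subgraph \<omega> K) \<le> d"
  shows "short_cycle_count r v (retained_subgraph \<omega> G) \<le> b * d"
proof -
  have sub: "subgraph K G" if "K \<in> \<K>" for K
    using cover that by (simp add: cycle_clique_cover_def)
  define B where "B = {K \<in> \<K>. v \<in> verts K}"
  define Z where "Z K = {C \<in> cycles (retained_subgraph \<omega> K). cycle_length C < r \<and> v \<in> verts C}" for K
  have finB: "finite B"
    by (rule finite_subset[OF _ finite_subgraphs[OF G]]) (use sub in \<open>auto simp: B_def\<close>)
  have fin_retained: "finite_simple_graph (retained_subgraph \<omega> K)" if "K \<in> \<K>" for K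
    using sub[OF that] by (auto simp: subgraph_def finite_simple_graph_def)
  have "enat (card B) \<le> enat b"
    unfolding overlap[symmetric] local_overlap_def
    by (rule SUP_upper2[OF v]) (use finB in \<open>simp add: B_def\<close>)
  then have card_B: "card B \<le> b" by simp
  have "Z G \<subseteq> (\<Union>K\<in>B. Z K)"
  proof
    fix C assume C: "C \<in> Z G"
    then have CG: "is_cycle C" "subgraph C (retained_subgraph \<omega> G)" "cycle_length C < r" "v \<in> verts C"
      by (auto simp: Z_def cycles_def)
    have "subgraph C G"
      using subgraph_trans[OF CG(2) subgraph_retained_subgraph[OF G]] .
    then obtain K where K: "K \<in> \<K>" "subgraph C K"
      using cover CG by (auto simp: cycle_clique_cover_def cycles_def)
    then have "subgraph C (retained_subgraph \<omega> K)"
      using CG(2) by (auto simp: subgraph_def)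
    then have "C \<in> Z K" using CG by (simp add: Z_def cycles_def)
    moreover have "K \<in> B" using K CG(4) by (auto simp: B_def subgraph_def)
    ultimately show "C \<in> (\<Union>K\<in>B. Z K)" by blast
  qed
  moreover have "finite (\<Union>K\<in>B. Z K)"
  proof (rule finite_UN_I[OF finB])
    fix K assume "K \<in> B"
    then show "finite (Z K)"
      using finite_cycles[OF fin_retained, of K] by (simp add: Z_def B_def)
  qed
  ultimately have "card (Z G) \<le> card (\<Union>K\<in>B. Z K)" by (intro card_mono)
  also have "\<dots> \<le> (\<Sum>K\<in>B. card (Z K))" using finB by (rule card_UN_le)
  also have "\<dots> \<le> (\<Sum>K\<in>B. d)"
    using few by (intro sum_mono) (auto simp: Z_def B_def short_cycle_count_def)
  also have "\<dots> \<le> b * d" using card_B by simp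
  finally show ?thesis by (simp add: short_cycle_count_def Z_def)
qed

section \<open>The quantitative lower bound\<close>

lemma high_girth_frac_chromatic_ge:
  assumes G: "finite_simple_graph G" and "subgraph H G" and "enat r \<le> girth H"
  shows "fractional_chromatic_number H \<le> high_girth_frac_chromatic r G"
  unfolding high_girth_frac_chromatic_def
proof (rule Max_ge)
  show "finite {fractional_chromatic_number H |H. subgraph H G \<and> enat r \<le> girth H}"
    by (rule finite_subset[of _ "fractional_chromatic_number ` {H. subgraph H G}"])
      (use finite_subgraphs[OF G] in auto)
qed (use assms in blast)

text \<open>The subgraph found has vertex weight at least \<open>1 / (b * D + 1)\<close> while its
  independent sets weigh at most \<open>L / t\<close>; weak duality turns the quotient into the
  bound.\<close>

lemma high_girth_frac_chromatic_bound:
  fixes G :: "'a graph" and p D \<xi> t :: real and b :: nat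
  assumes G: "finite_simple_graph G" and t: "t = fractional_chromatic_number G" "2 \<le> t"
    and cover: "cycle_clique_cover r G \<K>" and p: "0 < p" "p < 1"
    and overlap: "local_overlap G \<K> = enat b" and D: "0 \<le> D"
    and \<xi>: "\<xi> < 1 / (2 * t)"
    and tail: "(\<Sum>K\<in>\<K>. \<Sum>v\<in>verts K. prob_many_short_cycles r p D K v) \<le> \<xi>"
  shows "t / ((real b * D + 1) * (8 * log (1 / (1 - p)) (2 * exp 1 * t) + 4))
    \<le> high_girth_frac_chromatic r G"
proof -
  define L where "L = 8 * log (1 / (1 - p)) (2 * exp 1 * t) + 4"
  let ?M = "Pi_pmf (edges G) False (\<lambda>_. bernoulli_pmf p)"
  have "1 \<le> 2 * exp 1 * t"
  proof -
    have "1 * 1 \<le> (2 * exp 1) * t" using t(2) exp_ge_add_one_self[of 1] by (intro mult_mono) auto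
    then show ?thesis by simp
  qed
  then have "0 \<le> log (1 / (1 - p)) (2 * exp 1 * t)"
    using p by (simp add: log_def)
  then have L: "0 < L" by (simp add: L_def)
  obtain \<mu> where \<mu>: "\<And>v. v \<in> verts G \<Longrightarrow> 0 \<le> \<mu> v" "sum \<mu> (verts G) = 1"
    and \<mu>_prob: "measure_pmf.prob ?M
       {\<omega>. \<exists>S\<in>independent_sets (retained_subgraph \<omega> G). L / t \<le> sum \<mu> S} \<le> 3 / 5"
    unfolding L_def using heavy_independent_sets_unlikely[OF G t(1) _ p] t(2) by auto
  define heavy where "heavy = {\<omega>. \<exists>S\<in>independent_sets (retained_subgraph \<omega> G). L / t \<le> sum \<mu> S}"
  define many where
    "many K v = {\<omega>. D < real (short_cycle_count r v (retained_subgraph \<omega> K))}" for K :: "'a graph" and v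
  have sub: "subgraph K G" if "K \<in> \<K>" for K
    using cover that by (simp add: cycle_clique_cover_def)
  \<comment> \<open>A cover consists of subgraphs of a finite graph, so the tail sum is a genuine
    finite sum and not the default 0.\<close>
  have fin\<K>: "finite \<K>"
    by (rule finite_subset[OF _ finite_subgraphs[OF G]]) (use sub in auto)
  have finK: "finite (verts K)" if "K \<in> \<K>" for K
    using sub[OF that] by (simp add: subgraph_def finite_simple_graph_def)
  have prob_many: "measure_pmf.prob ?M (many K v) = prob_many_short_cycles r p D K v"
    if "K \<in> \<K>" for K v
    by (simp add: prob_many_short_cycles_def random_spanning_subgraph_eq_map_Pi_pmf[OF G sub[OF that]]
        many_def vimage_def)
  have "measure_pmf.prob ?M (heavy \<union> (\<Union>K\<in>\<K>. \<Union>v\<in>verts K. many K v))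
      \<le> measure_pmf.prob ?M heavy + measure_pmf.prob ?M (\<Union>K\<in>\<K>. \<Union>v\<in>verts K. many K v)"
    by (rule measure_Un_le) auto
  also have "\<dots> \<le> 3 / 5 + (\<Sum>K\<in>\<K>. \<Sum>v\<in>verts K. measure_pmf.prob ?M (many K v))"
  proof (rule add_mono)
    show "measure_pmf.prob ?M heavy \<le> 3 / 5" using \<mu>_prob by (simp add: heavy_def)
    have "measure_pmf.prob ?M (\<Union>K\<in>\<K>. \<Union>v\<in>verts K. many K v)
        \<le> (\<Sum>K\<in>\<K>. measure_pmf.prob ?M (\<Union>v\<in>verts K. many K v))"
      using fin\<K> by (intro measure_UNION_le) auto
    also have "\<dots> \<le> (\<Sum>K\<in>\<K>. \<Sum>v\<in>verts K. measure_pmf.prob ?M (many K v))"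
      using finK by (intro sum_mono measure_UNION_le) auto
    finally show "measure_pmf.prob ?M (\<Union>K\<in>\<K>. \<Union>v\<in>verts K. many K v)
        \<le> (\<Sum>K\<in>\<K>. \<Sum>v\<in>verts K. measure_pmf.prob ?M (many K v))" .
  qed
  also have "\<dots> \<le> 3 / 5 + \<xi>" using tail by (simp add: prob_many)
  also have "\<dots> < 1"
  proof -
    have "1 / (2 * t) \<le> 1 / 4" using t(2) by (simp add: field_simps)
    then show ?thesis using \<xi> by simp
  qed
  \<comment> \<open>All bad events together have probability below 1, so one configuration \<omega>
    avoids them simultaneously.\<close>
  finally have "heavy \<union> (\<Union>K\<in>\<K>. \<Union>v\<in>verts K. many K v) \<noteq> UNIV"
    by (metis measure_pmf.prob_space order_less_irrefl space_measure_pmf)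
  then obtain \<omega> where \<omega>: "\<omega> \<notin> heavy" "\<And>K v. K \<in> \<K> \<Longrightarrow> v \<in> verts K \<Longrightarrow> \<omega> \<notin> many K v"
    by blast
  define H where "H = retained_subgraph \<omega> G"
  have HG: "subgraph H G" unfolding H_def by (rule subgraph_retained_subgraph[OF G])
  then have H: "finite_simple_graph H" by (simp add: subgraph_def)
  \<comment> \<open>Cycle counts are integers, so a count of at most \<open>D\<close> is at most its
    floor.\<close>
  define s where "s = b * nat \<lfloor>D\<rfloor>"
  have "short_cycle_count r v H \<le> s" if "v \<in> verts H" for v
    unfolding H_def s_def
  proof (rule short_cycle_count_retained_le[OF G cover overlap])
    show "short_cycle_count r v (retained_subgraph \<omega> K) \<le> nat \<lfloor>D\<rfloor>"
      if "K \<in> \<K>" "v \<in> verts K" for K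
      using \<omega>(2)[OF that] by (simp add: many_def le_nat_floor)
  qed (use that in \<open>simp add: H_def\<close>)
  from high_girth_partition[OF H this] obtain f :: "'a \<Rightarrow> nat" where
    f: "f ` verts H \<subseteq> {..s}" "\<And>i. enat r \<le> girth (induced_subgraph H {v. f v = i})"
    by metis
  have verts_H: "verts H = verts G" by (simp add: H_def)
  have finV: "finite (verts G)" using G by (simp add: finite_simple_graph_def)
  \<comment> \<open>Pigeonhole: the \<open>s + 1\<close> colour classes share total weight
    1.\<close>
  have "\<exists>i\<in>{..s}. 1 / real (s + 1) \<le> sum \<mu> (verts H \<inter> {v. f v = i})"
  proof (rule ccontr)
    assume "\<not> ?thesis"
    then have "(\<Sum>i\<le>s. sum \<mu> (verts H \<inter> {v. f v = i})) < (\<Sum>i\<le>s. 1 / real (s + 1))"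
      by (intro sum_strict_mono) (auto simp: not_le)
    also have "\<dots> = 1" by simp
    also have "(\<Sum>i\<le>s. sum \<mu> (verts H \<inter> {v. f v = i})) = (\<Sum>i\<le>s. \<Sum>v | v \<in> verts H \<and> f v = i. \<mu> v)"
      by (simp add: Collect_conj_eq)
    also have "\<dots> = sum \<mu> (verts H)"
      using f(1) finV by (intro sum.group) (auto simp: verts_H)
    also have "\<dots> = 1" using \<mu>(2) by (simp add: verts_H)
    finally show False by simp
  qed
  then obtain i where i: "1 / real (s + 1) \<le> sum \<mu> (verts H \<inter> {v. f v = i})" by blast
  define A where "A = induced_subgraph H {v. f v = i}"
  have AH: "subgraph A H" unfolding A_def by (rule subgraph_induced_subgraph[OF H])
  have A: "finite_simple_graph A" using AH by (simp add: subgraph_def)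
  have "real s \<le> real b * D"
    using D by (auto simp: s_def intro!: mult_left_mono of_nat_floor)
  then have "1 / (real b * D + 1) \<le> 1 / real (s + 1)"
    by (intro divide_left_mono) auto
  also have "\<dots> \<le> sum \<mu> (verts A)" using i by (simp add: A_def)
  finally have "1 / (real b * D + 1) / (L / t) \<le> sum \<mu> (verts A) / (L / t)"
    using L t(2) by (intro divide_right_mono) auto
  also have "\<dots> \<le> fractional_chromatic_number A"
  proof (rule fractional_chromatic_number_ge[OF A])
    fix I assume "I \<in> independent_sets A"
    then have "I \<in> independent_sets H"
      using independent_sets_induced_subgraph by (auto simp: A_def)
    then show "sum \<mu> I \<le> L / t" using \<omega>(1) by (force simp: heavy_def H_def)
  qed (use \<mu>(1) L t(2) verts_H in \<open>auto simp: A_def\<close>)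
  also have "\<dots> \<le> high_girth_frac_chromatic r G"
    by (rule high_girth_frac_chromatic_ge[OF G subgraph_trans[OF AH HG]]) (use f(2) in \<open>simp add: A_def\<close>)
  finally show ?thesis by (simp add: L_def)
qed

section \<open>The asymptotic consequence\<close>

text \<open>Since \<open>ln (1 / (1 - p)) \<ge> p\<close>, the logarithm to base
  \<open>1 / (1 - p)\<close> costs at most a factor \<open>1 / p\<close> over the natural one. This
  is uniform in \<open>p\<close>, so \<open>p n\<close> may approach 0 or 1.\<close>

lemma filterlim_bound_at_top:
  fixes p t B :: "nat \<Rightarrow> real"
  assumes p: "\<And>n. 0 < p n" "\<And>n. p n < 1" and B: "\<And>n. 1 \<le> B n"
    and t: "filterlim t at_top sequentially"
    and small: "B \<in> o(\<lambda>n. p n * t n / ln (t n))"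
  shows "filterlim (\<lambda>n. t n / (B n * (8 * log (1 / (1 - p n)) (2 * exp 1 * t n) + 4)))
    at_top sequentially"
  unfolding filterlim_at_top
proof
  fix Z :: real
  \<comment> \<open>The 24 comes from \<open>8 * (x + 2) + 4 \<le> 24 * x\<close> for
    \<open>x = ln (t n) \<ge> 2\<close>; the maximum with 1 handles nonpositive
    \<open>Z\<close>.\<close>
  define c where "c = 1 / (24 * max 1 Z)"
  have c: "0 < c" by (simp add: c_def)
  have "\<forall>\<^sub>F n in sequentially. norm (B n) \<le> c * norm (p n * t n / ln (t n))"
    using landau_o.smallD[OF small c] .
  moreover have "\<forall>\<^sub>F n in sequentially. exp 2 \<le> t n"
    using t by (simp add: filterlim_at_top)
  ultimately show "\<forall>\<^sub>F n in sequentially.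
      Z \<le> t n / (B n * (8 * log (1 / (1 - p n)) (2 * exp 1 * t n) + 4))"
  proof eventually_elim
    case (elim n)
    define x where "x = ln (t n)"
    have t0: "0 < t n" using elim(2) by (smt (verit) exp_gt_zero)
    have x: "2 \<le> x" using elim(2) t0 by (simp add: x_def ln_ge_iff)
    have ln_et: "ln (2 * exp 1 * t n) \<le> x + 2"
      using t0 ln_2_less_1 by (simp add: ln_mult x_def)
    have "p n \<le> - ln (1 - p n)" using ln_le_minus_one[of "1 - p n"] p[of n] by simp
    then have "p n \<le> ln (1 / (1 - p n))" using p[of n] by (simp add: ln_div)
    then have "log (1 / (1 - p n)) (2 * exp 1 * t n) \<le> (x + 2) / p n"
      unfolding log_def using ln_et p[of n] x by (intro frac_le) auto
    moreover have "4 \<le> 4 / p n" using p[of n] by (simp add: field_simps)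
    ultimately have "8 * log (1 / (1 - p n)) (2 * exp 1 * t n) + 4 \<le> (8 * (x + 2) + 4) / p n"
      by (simp add: add_divide_distrib)
    also have "\<dots> \<le> 24 * x / p n"
      using x p[of n] by (intro divide_right_mono) auto
    finally have den: "8 * log (1 / (1 - p n)) (2 * exp 1 * t n) + 4 \<le> 24 * x / p n" .
    have "0 \<le> log (1 / (1 - p n)) (2 * exp 1 * t n)"
    proof -
      have "ln (2 * exp 1 * t n) = ln 2 + 1 + x" using t0 by (simp add: ln_mult x_def)
      moreover have "0 < ln (2 :: real)" by simp
      ultimately have "0 \<le> ln (2 * exp 1 * t n)" using x by linarith
      then show ?thesis using p[of n] by (simp add: log_def)
    qed
    then have den0: "0 < 8 * log (1 / (1 - p n)) (2 * exp 1 * t n) + 4" by simp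
    have Bn: "B n \<le> c * (p n * t n / x)"
      using elim(1) B[of n] p[of n] t0 x by (simp add: x_def)
    have "max 1 Z * (B n * (24 * x / p n)) \<le> max 1 Z * (c * (p n * t n / x) * (24 * x / p n))"
      using Bn p[of n] x by (intro mult_left_mono mult_right_mono) auto
    also have "\<dots> = t n"
    proof -
      have "max 1 Z * (c * 24) = 1" by (simp add: c_def)
      moreover have "max 1 Z * (c * (p n * t n / x) * (24 * x / p n)) = max 1 Z * (c * 24) * t n"
        using p(1)[of n] x by (simp add: field_simps)
      ultimately show ?thesis by simp
    qed
    finally have "max 1 Z * (B n * (24 * x / p n)) \<le> t n" .
    moreover have "max 1 Z * (B n * (8 * log (1 / (1 - p n)) (2 * exp 1 * t n) + 4))
        \<le> max 1 Z * (B n * (24 * x / p n))"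
      using den B[of n] by (intro mult_left_mono) auto
    ultimately have "max 1 Z * (B n * (8 * log (1 / (1 - p n)) (2 * exp 1 * t n) + 4)) \<le> t n"
      by (rule order_trans[rotated])
    moreover have "0 < B n * (8 * log (1 / (1 - p n)) (2 * exp 1 * t n) + 4)"
      using den0 B[of n] by (intro mult_pos_pos) auto
    ultimately have "max 1 Z \<le> t n / (B n * (8 * log (1 / (1 - p n)) (2 * exp 1 * t n) + 4))"
      by (subst pos_le_divide_eq)
    then show ?case by simp
  qed
qed

theorem theorem9p16:
  fixes r :: nat
  assumes "r \<ge> 4"
  shows
    "(\<forall>(G :: 'a graph) \<K> (p :: real) (D :: real) (\<xi> :: real) (b :: nat) (t :: real).
        finite_simple_graph G \<longrightarrow>
        t = fractional_chromatic_number G \<longrightarrow> t \<ge> 2 \<longrightarrow>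
        cycle_clique_cover r G \<K> \<longrightarrow>
        0 < p \<longrightarrow> p < 1 \<longrightarrow>
        local_overlap G \<K> = enat b \<longrightarrow>
        D \<ge> 0 \<longrightarrow> 0 < \<xi> \<longrightarrow> \<xi> < 1 / (2 * t) \<longrightarrow>
        (\<Sum>K\<in>\<K>. \<Sum>v\<in>verts K. prob_many_short_cycles r p D K v) \<le> \<xi> \<longrightarrow>
        high_girth_frac_chromatic r G
          \<ge> t / ((real b * D + 1) * (8 * log (1 / (1 - p)) (2 * exp 1 * t) + 4)))
     \<and>
     (\<forall>(G :: nat \<Rightarrow> 'a graph) (\<K> :: nat \<Rightarrow> 'a graph set) (p :: nat \<Rightarrow> real) (D :: nat \<Rightarrow> real)
        (\<xi> :: nat \<Rightarrow> real) (b :: nat \<Rightarrow> nat) (t :: nat \<Rightarrow> real).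
        (\<forall>n. finite_simple_graph (G n) \<and>
             t n = fractional_chromatic_number (G n) \<and>
             cycle_clique_cover r (G n) (\<K> n) \<and>
             0 < p n \<and> p n < 1 \<and>
             local_overlap (G n) (\<K> n) = enat (b n) \<and>
             D n \<ge> 0 \<and> 0 < \<xi> n \<and> \<xi> n < 1 / (2 * t n) \<and>
             (\<Sum>K\<in>\<K> n. \<Sum>v\<in>verts K. prob_many_short_cycles r (p n) (D n) K v) \<le> \<xi> n) \<longrightarrow>
        filterlim t at_top sequentially \<longrightarrow>
        (\<lambda>n. real (b n) * D n + 1) \<in> o(\<lambda>n. p n * t n / ln (t n)) \<longrightarrow>
        filterlim (\<lambda>n. high_girth_frac_chromatic r (G n)) at_top sequentially)"
proof (intro conjI allI impI)
  fix G :: "'a graph" and \<K> and p D \<xi> :: real and b and t :: real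
  assume "finite_simple_graph G" "t = fractional_chromatic_number G" "2 \<le> t"
    "cycle_clique_cover r G \<K>" "0 < p" "p < 1" "local_overlap G \<K> = enat b" "0 \<le> D"
    "\<xi> < 1 / (2 * t)" "(\<Sum>K\<in>\<K>. \<Sum>v\<in>verts K. prob_many_short_cycles r p D K v) \<le> \<xi>"
  then show "t / ((real b * D + 1) * (8 * log (1 / (1 - p)) (2 * exp 1 * t) + 4))
      \<le> high_girth_frac_chromatic r G"
    by (rule high_girth_frac_chromatic_bound)
next
  fix G :: "nat \<Rightarrow> 'a graph" and \<K> and p D \<xi> :: "nat \<Rightarrow> real" and b and t :: "nat \<Rightarrow> real"
  assume hyp: "\<forall>n. finite_simple_graph (G n) \<and> t n = fractional_chromatic_number (G n) \<and>
      cycle_clique_cover r (G n) (\<K> n) \<and> 0 < p n \<and> p n < 1 \<and>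
      local_overlap (G n) (\<K> n) = enat (b n) \<and> D n \<ge> 0 \<and> 0 < \<xi> n \<and> \<xi> n < 1 / (2 * t n) \<and>
      (\<Sum>K\<in>\<K> n. \<Sum>v\<in>verts K. prob_many_short_cycles r (p n) (D n) K v) \<le> \<xi> n"
    and t: "filterlim t at_top sequentially"
    and small: "(\<lambda>n. real (b n) * D n + 1) \<in> o(\<lambda>n. p n * t n / ln (t n))"
  \<comment> \<open>The quantitative bound requires \<open>t n \<ge> 2\<close>, which holds only
    from some index on; divergence needs no more.\<close>
  have "\<forall>\<^sub>F n in sequentially. 2 \<le> t n" using t by (simp add: filterlim_at_top)
  then have "\<forall>\<^sub>F n in sequentially.
      t n / ((real (b n) * D n + 1) * (8 * log (1 / (1 - p n)) (2 * exp 1 * t n) + 4))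
      \<le> high_girth_frac_chromatic r (G n)"
  proof eventually_elim
    case (elim n)
    from hyp[rule_format, of n] elim show ?case
      by (elim conjE) (rule high_girth_frac_chromatic_bound)
  qed
  moreover have "filterlim
      (\<lambda>n. t n / ((real (b n) * D n + 1) * (8 * log (1 / (1 - p n)) (2 * exp 1 * t n) + 4)))
      at_top sequentially"
    using hyp by (intro filterlim_bound_at_top[OF _ _ _ t small]) auto
  ultimately show "filterlim (\<lambda>n. high_girth_frac_chromatic r (G n)) at_top sequentially"
    by (rule filterlim_at_top_mono[rotated])
qed

end
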